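(* Let $K:\mathcal X\times\mathcal X\to\mathbb R$ be a positive definite symmetric kernel with $r^2=\sup_xK(x,x)<\infty$ and reproducing kernel Hilbert space $\mathcal H$, and let $L$ be a convex and $\sigma$-admissible loss function. Let $\mathbf q=(q_1,\dots,q_T)$ be any non-negative weight vector and $\lambda>0$. Then the kernel-based regularization algorithm that, given a sample $\mathbf Z_1^T=(Z_1,\dots,Z_T)\in\mathcal Z^T$, returns the minimizer over $h\in\mathcal H$ of $$F_{\mathbf Z_1^T}(h,\mathbf q)=\sum_{t=1}^Tq_tL(h,Z_t)+\lambda\|h\|_{\mathcal H}^2$$ is $\beta$-stable with $\beta\le\dfrac{\sigma^2r^2\|\mathbf q\|_\infty}{\lambda}$.
   Context: $\mathcal Z=\mathcal X\times\mathcal Y$ with $\mathcal Y\subseteq\mathbb R$; for $z=(x,y)$, $L(h,z)=L(h(x),y)\ge0$; $L$ convex means convex in its first argument. $L$ is $\sigma$-admissible if for all hypotheses $h,h'$ and all $z=(x,y)\in\mathcal Z$, $|L(h,z)-L(h',z)|\le\sigma|h(x)-h'(x)|$. An algorithm returning $h(\mathbf z)$ on sample $\mathbf z$ is (uniformly) $\beta$-stable if for any $z\in\mathcal Z$ and any two samples $\mathbf z,\mathbf z'$ differing by exactly one point (in the same position), $|L(h(\mathbf z),z)-L(h(\mathbf z'),z)|\le\beta$. *)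

theory Defs
  imports "HOL-Analysis.Analysis"
begin

text \<open>
  As usual for kernels, ``positive definite'' means that all Gram matrices are symmetric and
  positive \<^emph>\<open>semi\<close>definite.
\<close>

definition pds_kernel :: "('x \<Rightarrow> 'x \<Rightarrow> real) \<Rightarrow> bool" where
  "pds_kernel K \<longleftrightarrow>
     (\<forall>x x'. K x x' = K x' x) \<and>
     (\<forall>S c. finite S \<longrightarrow> 0 \<le> (\<Sum>x\<in>S. \<Sum>x'\<in>S. c x * c x' * K x x'))"

definition ip_norm :: "(('x \<Rightarrow> real) \<Rightarrow> ('x \<Rightarrow> real) \<Rightarrow> real) \<Rightarrow> ('x \<Rightarrow> real) \<Rightarrow> real" where
  "ip_norm ip h = sqrt (ip h h)"

text \<open>
  The Hilbert spaces below are genuine sets of functions with pointwise operations. The inner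
  product \<open>ip\<close> is only constrained on \<open>H\<close>.
\<close>

locale hilbert_function_space =
  fixes H :: "('x \<Rightarrow> real) set"
    and ip :: "('x \<Rightarrow> real) \<Rightarrow> ('x \<Rightarrow> real) \<Rightarrow> real"
  assumes zero_mem: "(\<lambda>_. 0) \<in> H"
    and add_mem: "\<lbrakk>f \<in> H; g \<in> H\<rbrakk> \<Longrightarrow> (\<lambda>x. f x + g x) \<in> H"
    and scale_mem: "f \<in> H \<Longrightarrow> (\<lambda>x. c * f x) \<in> H"
    and ip_commute: "\<lbrakk>f \<in> H; g \<in> H\<rbrakk> \<Longrightarrow> ip f g = ip g f"
    and ip_add_left: "\<lbrakk>f \<in> H; g \<in> H; h \<in> H\<rbrakk> \<Longrightarrow> ip (\<lambda>x. f x + g x) h = ip f h + ip g h"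
    and ip_scale_left: "\<lbrakk>f \<in> H; g \<in> H\<rbrakk> \<Longrightarrow> ip (\<lambda>x. c * f x) g = c * ip f g"
    and ip_ge_zero: "f \<in> H \<Longrightarrow> 0 \<le> ip f f"
    and ip_eq_zero_iff: "f \<in> H \<Longrightarrow> ip f f = 0 \<longleftrightarrow> f = (\<lambda>_. 0)"
    and complete:
      "\<lbrakk>\<And>n. u n \<in> H;
        \<And>e. 0 < e \<Longrightarrow> \<exists>N::nat. \<forall>m\<ge>N. \<forall>n\<ge>N. ip_norm ip (\<lambda>x. u m x - u n x) < e\<rbrakk>
       \<Longrightarrow> \<exists>f\<in>H. (\<lambda>n. ip_norm ip (\<lambda>x. u n x - f x)) \<longlonglongrightarrow> 0"

locale rkhs = hilbert_function_space H ip
  for H :: "('x \<Rightarrow> real) set"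
    and ip :: "('x \<Rightarrow> real) \<Rightarrow> ('x \<Rightarrow> real) \<Rightarrow> real" +
  fixes K :: "'x \<Rightarrow> 'x \<Rightarrow> real"
  assumes kernel_mem: "K x \<in> H"
    and reproducing: "h \<in> H \<Longrightarrow> ip h (K x) = h x"

text \<open>
  The input space is the type \<open>'x\<close>; the label space is a set \<open>Y\<close> of reals. A loss takes the
  predicted value and the true label, so that \<open>L (h x) y\<close> is the loss of \<open>h\<close> at \<open>(x, y)\<close>.
\<close>

definition convex_loss :: "real set \<Rightarrow> (real \<Rightarrow> real \<Rightarrow> real) \<Rightarrow> bool" where
  "convex_loss Y L \<longleftrightarrow> (\<forall>y\<in>Y. convex_on UNIV (\<lambda>u. L u y))"

definition admissible_loss ::
  "('x \<Rightarrow> real) set \<Rightarrow> real set \<Rightarrow> (real \<Rightarrow> real \<Rightarrow> real) \<Rightarrow> real \<Rightarrow> bool" where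
  "admissible_loss H Y L \<sigma> \<longleftrightarrow>
     (\<forall>h\<in>H. \<forall>h'\<in>H. \<forall>(x, y)\<in>UNIV \<times> Y. \<bar>L (h x) y - L (h' x) y\<bar> \<le> \<sigma> * \<bar>h x - h' x\<bar>)"

text \<open>Samples are vectors indexed by a finite type whose cardinality is the sample size.\<close>

definition samples :: "real set \<Rightarrow> (('x \<times> real) ^ 'n) set" where
  "samples Y = {Z. \<forall>t. Z $ t \<in> UNIV \<times> Y}"

definition differ_by_one :: "'a ^ 'n \<Rightarrow> 'a ^ 'n \<Rightarrow> bool" where
  "differ_by_one Z Z' \<longleftrightarrow> (\<exists>t. Z $ t \<noteq> Z' $ t \<and> (\<forall>s. s \<noteq> t \<longrightarrow> Z $ s = Z' $ s))"

definition uniformly_stable ::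
  "real set \<Rightarrow> (real \<Rightarrow> real \<Rightarrow> real) \<Rightarrow> (('x \<times> real) ^ 'n \<Rightarrow> 'x \<Rightarrow> real) \<Rightarrow> real \<Rightarrow> bool" where
  "uniformly_stable Y L A \<beta> \<longleftrightarrow>
     (\<forall>Z\<in>samples Y. \<forall>Z'\<in>samples Y. differ_by_one Z Z' \<longrightarrow>
        (\<forall>(x, y)\<in>UNIV \<times> Y. \<bar>L (A Z x) y - L (A Z' x) y\<bar> \<le> \<beta>))"

definition regularized_objective ::
  "(('x \<Rightarrow> real) \<Rightarrow> ('x \<Rightarrow> real) \<Rightarrow> real) \<Rightarrow> (real \<Rightarrow> real \<Rightarrow> real) \<Rightarrow> real \<Rightarrow>
   real ^ 'n \<Rightarrow> ('x \<times> real) ^ 'n \<Rightarrow> ('x \<Rightarrow> real) \<Rightarrow> real" where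
  "regularized_objective ip L lam q Z h =
     (\<Sum>t\<in>UNIV. q $ t * L (h (fst (Z $ t))) (snd (Z $ t))) + lam * (ip_norm ip h)\<^sup>2"

definition kernel_regularization ::
  "('x \<Rightarrow> real) set \<Rightarrow> (('x \<Rightarrow> real) \<Rightarrow> ('x \<Rightarrow> real) \<Rightarrow> real) \<Rightarrow> (real \<Rightarrow> real \<Rightarrow> real) \<Rightarrow> real \<Rightarrow>
   real ^ 'n \<Rightarrow> ('x \<times> real) ^ 'n \<Rightarrow> ('x \<Rightarrow> real)" where
  "kernel_regularization H ip L lam q Z =
     arg_min (regularized_objective ip L lam q Z) (\<lambda>h. h \<in> H)"

end

theory Submission
  imports Defs
begin

text \<open>
  The objective \<open>F\<close> is strongly convex: along a segment it lies below the chord by at least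
  \<open>lam * s * (1 - s) * \<parallel>f - g\<parallel>\<^sup>2\<close>. Hence every minimizing sequence is Cauchy, which gives existence
  and uniqueness of the minimizer, and \<open>F\<close> grows by at least \<open>lam * \<parallel>g - h\<parallel>\<^sup>2\<close> away from its
  minimizer \<open>h\<close>. For samples differing in position \<open>t\<close>, adding the growth inequalities at the two
  minimizers \<open>h\<close>, \<open>h'\<close> leaves only the terms of index \<open>t\<close>, so that admissibility and the reproducing
  property give \<open>2 * lam * \<parallel>h - h'\<parallel>\<^sup>2 \<le> 2 * q\<^sub>t * \<bar>\<sigma>\<bar> * \<bar>r\<bar> * \<parallel>h - h'\<parallel>\<close>. One more use of both
  turns this into the stability bound.
\<close>

section \<open>Inner product identities and norm convergence\<close>

context hilbert_function_space
begin

lemma ip_scale_right: "\<lbrakk>f \<in> H; g \<in> H\<rbrakk> \<Longrightarrow> ip f (\<lambda>x. c * g x) = c * ip f g"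
  using ip_commute[of f "\<lambda>x. c * g x"] ip_commute[of f g] ip_scale_left[of g f c] scale_mem[of g c]
  by simp

lemma ip_add_right: "\<lbrakk>f \<in> H; g \<in> H; h \<in> H\<rbrakk> \<Longrightarrow> ip h (\<lambda>x. f x + g x) = ip h f + ip h g"
  using ip_commute[of h "\<lambda>x. f x + g x"] ip_commute[of h f] ip_commute[of h g]
    ip_add_left[of f g h] add_mem[of f g]
  by simp

lemma lincomb_mem: "\<lbrakk>f \<in> H; g \<in> H\<rbrakk> \<Longrightarrow> (\<lambda>x. a * f x + b * g x) \<in> H"
  using add_mem[OF scale_mem scale_mem] .

lemma diff_mem: "\<lbrakk>f \<in> H; g \<in> H\<rbrakk> \<Longrightarrow> (\<lambda>x. f x - g x) \<in> H"
  using lincomb_mem[of f g 1 "-1"] by simp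

lemma ip_lincomb:
  assumes "f \<in> H" "g \<in> H"
  shows "ip (\<lambda>x. a * f x + b * g x) (\<lambda>x. a * f x + b * g x) =
    a\<^sup>2 * ip f f + 2 * a * b * ip f g + b\<^sup>2 * ip g g"
proof -
  have m: "(\<lambda>x. a * f x) \<in> H" "(\<lambda>x. b * g x) \<in> H"
    using assms by (auto intro: scale_mem)
  show ?thesis
    using assms m lincomb_mem[OF assms, of a b] ip_commute[of g f]
    by (simp add: ip_add_left ip_add_right ip_scale_left ip_scale_right
        power2_eq_square algebra_simps)
qed

lemma ip_diff:
  assumes "f \<in> H" "g \<in> H"
  shows "ip (\<lambda>x. f x - g x) (\<lambda>x. f x - g x) = ip f f - 2 * ip f g + ip g g"
  using ip_lincomb[OF assms, of 1 "-1"] by simp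

lemma ip_norm_sq: "f \<in> H \<Longrightarrow> (ip_norm ip f)\<^sup>2 = ip f f"
  by (simp add: ip_norm_def ip_ge_zero)

lemma ip_norm_ge_zero: "f \<in> H \<Longrightarrow> 0 \<le> ip_norm ip f"
  by (simp add: ip_norm_def ip_ge_zero)

lemma ip_norm_diff_commute:
  assumes "f \<in> H" "g \<in> H"
  shows "ip_norm ip (\<lambda>x. f x - g x) = ip_norm ip (\<lambda>x. g x - f x)"
  unfolding ip_norm_def ip_diff[OF assms] ip_diff[OF assms(2,1)] ip_commute[OF assms(2,1)]
  by simp

lemma Cauchy_Schwarz:
  assumes f: "f \<in> H" and g: "g \<in> H"
  shows "\<bar>ip f g\<bar> \<le> ip_norm ip f * ip_norm ip g"
proof (cases "ip g g = 0")
  case True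
  then have "g = (\<lambda>_. 0)"
    using ip_eq_zero_iff g by blast
  then have "ip f g = 0"
    using ip_scale_right[OF f g, of 0] by simp
  then show ?thesis
    using ip_norm_ge_zero f g by simp
next
  case False
  then have pos: "0 < ip g g"
    using ip_ge_zero[OF g] by simp
  \<comment> \<open>This vector is \<open>ip g g\<close> times the component of \<open>f\<close>
    orthogonal to \<open>g\<close>; the scaling avoids a division.\<close>
  have "0 \<le> ip (\<lambda>x. ip g g * f x + (- ip f g) * g x) (\<lambda>x. ip g g * f x + (- ip f g) * g x)"
    using f g by (intro ip_ge_zero lincomb_mem)
  also have "\<dots> = ip g g * (ip f f * ip g g - (ip f g)\<^sup>2)"
    unfolding ip_lincomb[OF f g] by (simp add: power2_eq_square algebra_simps)
  finally have "(ip f g)\<^sup>2 \<le> ip f f * ip g g"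
    using pos by (simp add: zero_le_mult_iff)
  then have "sqrt ((ip f g)\<^sup>2) \<le> sqrt (ip f f * ip g g)"
    by (rule real_sqrt_le_mono)
  then show ?thesis
    by (simp add: ip_norm_def real_sqrt_mult)
qed

text \<open>Expanding both sides shows that the convexity gap of the squared norm is an exact
  multiple of the squared distance. This is what makes the regularizer strongly convex.\<close>

lemma ip_norm_sq_segment:
  assumes f: "f \<in> H" and g: "g \<in> H"
  shows "(ip_norm ip (\<lambda>x. (1 - s) * f x + s * g x))\<^sup>2 =
    (1 - s) * (ip_norm ip f)\<^sup>2 + s * (ip_norm ip g)\<^sup>2
      - s * (1 - s) * (ip_norm ip (\<lambda>x. f x - g x))\<^sup>2"
  unfolding ip_norm_sq[OF f] ip_norm_sq[OF g] ip_norm_sq[OF lincomb_mem[OF f g]]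
    ip_norm_sq[OF diff_mem[OF f g]] ip_lincomb[OF f g] ip_diff[OF f g]
  by (simp add: power2_eq_square algebra_simps)

text \<open>Write \<open>u n\<close> as \<open>f\<close> plus the difference; the cross term
  vanishes in the limit by Cauchy-Schwarz.\<close>

lemma tendsto_ip_norm_sq:
  assumes u: "\<And>n::nat. u n \<in> H" and f: "f \<in> H"
    and lim: "(\<lambda>n. ip_norm ip (\<lambda>x. u n x - f x)) \<longlonglongrightarrow> 0"
  shows "(\<lambda>n. (ip_norm ip (u n))\<^sup>2) \<longlonglongrightarrow> (ip_norm ip f)\<^sup>2"
proof -
  let ?d = "\<lambda>n x. u n x - f x"
  have d: "?d n \<in> H" for n
    by (rule diff_mem[OF u f])
  have "(\<lambda>n. ip_norm ip f * ip_norm ip (?d n)) \<longlonglongrightarrow> 0"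
    using tendsto_mult_right_zero[OF lim] .
  then have inner: "(\<lambda>n. ip f (?d n)) \<longlonglongrightarrow> 0"
    by (rule Lim_null_comparison[rotated]) (use Cauchy_Schwarz[OF f d] in simp)
  have expand: "(ip_norm ip (u n))\<^sup>2 =
      (ip_norm ip f)\<^sup>2 + 2 * ip f (?d n) + (ip_norm ip (?d n))\<^sup>2" for n
    using ip_lincomb[OF f d[of n], of 1 1] by (simp add: ip_norm_sq u f d)
  have "(\<lambda>n. (ip_norm ip f)\<^sup>2 + 2 * ip f (?d n) + (ip_norm ip (?d n))\<^sup>2)
      \<longlonglongrightarrow> (ip_norm ip f)\<^sup>2 + 2 * 0 + 0\<^sup>2"
    by (intro tendsto_intros inner lim)
  then show ?thesis
    by (simp add: expand)
qed

section \<open>Strong convexity: growth at a minimizer, existence and uniqueness\<close>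

definition strongly_convex :: "real \<Rightarrow> (('x \<Rightarrow> real) \<Rightarrow> real) \<Rightarrow> bool" where
  "strongly_convex c \<Phi> \<longleftrightarrow> (\<forall>f\<in>H. \<forall>g\<in>H. \<forall>s\<in>{0..1}.
     \<Phi> (\<lambda>x. (1 - s) * f x + s * g x) \<le>
       (1 - s) * \<Phi> f + s * \<Phi> g - c * s * (1 - s) * (ip_norm ip (\<lambda>x. f x - g x))\<^sup>2)"

lemma strongly_convexD:
  assumes "strongly_convex c \<Phi>" "f \<in> H" "g \<in> H" "0 \<le> s" "s \<le> 1"
  shows "\<Phi> (\<lambda>x. (1 - s) * f x + s * g x) \<le>
    (1 - s) * \<Phi> f + s * \<Phi> g - c * s * (1 - s) * (ip_norm ip (\<lambda>x. f x - g x))\<^sup>2"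
  using assms by (simp add: strongly_convex_def)

text \<open>Compare \<open>h\<close> with the points of the segment from \<open>h\<close> to
  \<open>g\<close>, divide by \<open>s\<close>, and let \<open>s\<close> tend to 0 from the right.
  The factor \<open>1 - s\<close> disappears in the limit, so the full constant \<open>c\<close>
  survives.\<close>

lemma strongly_convex_growth:
  assumes sc: "strongly_convex c \<Phi>"
    and min: "is_arg_min \<Phi> (\<lambda>h. h \<in> H) h" and g: "g \<in> H"
  shows "\<Phi> h + c * (ip_norm ip (\<lambda>x. h x - g x))\<^sup>2 \<le> \<Phi> g"
proof -
  let ?D = "(ip_norm ip (\<lambda>x. h x - g x))\<^sup>2"
  have h: "h \<in> H" and le: "\<And>f. f \<in> H \<Longrightarrow> \<Phi> h \<le> \<Phi> f"
    using min by (auto simp: is_arg_min_linorder)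
  have bound: "\<Phi> h + c * (1 - s) * ?D \<le> \<Phi> g" if "0 < s" "s \<le> 1" for s
  proof -
    have "\<Phi> h \<le> (1 - s) * \<Phi> h + s * \<Phi> g - c * s * (1 - s) * ?D"
      using le[OF lincomb_mem[OF h g, of "1 - s" s]] strongly_convexD[OF sc h g, of s] that
      by simp
    then have "s * (\<Phi> h + c * (1 - s) * ?D) \<le> s * \<Phi> g"
      by (simp add: algebra_simps)
    then show ?thesis
      using that by simp
  qed
  have "((\<lambda>s. \<Phi> h + c * (1 - s) * ?D) \<longlongrightarrow> \<Phi> h + c * (1 - 0) * ?D) (at_right 0)"
    by (intro tendsto_intros)
  then have "((\<lambda>s. \<Phi> h + c * (1 - s) * ?D) \<longlongrightarrow> \<Phi> h + c * ?D) (at_right 0)"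
    by simp
  moreover have "eventually (\<lambda>s. \<Phi> h + c * (1 - s) * ?D \<le> \<Phi> g) (at_right 0)"
    by (rule eventually_mono[OF eventually_at_right_real[of 0 1]]) (auto intro: bound)
  ultimately show ?thesis
    by (rule tendsto_upperbound) simp
qed

text \<open>Strong convexity takes the place of compactness: a minimizing sequence is Cauchy,
  completeness gives its limit, and continuity carries the infimum to that limit.\<close>

lemma strongly_convex_ex1_arg_min:
  assumes sc: "strongly_convex c \<Phi>" and c: "0 < c"
    and bdd: "\<And>f. f \<in> H \<Longrightarrow> b \<le> \<Phi> f"
    and cont: "\<And>u f. \<lbrakk>\<And>n. u n \<in> H; f \<in> H; (\<lambda>n. ip_norm ip (\<lambda>x. u n x - f x)) \<longlonglongrightarrow> 0\<rbrakk>
      \<Longrightarrow> (\<lambda>n. \<Phi> (u n)) \<longlonglongrightarrow> \<Phi> f"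
  shows "\<exists>!h. is_arg_min \<Phi> (\<lambda>h. h \<in> H) h"
proof -
  define m where "m = Inf (\<Phi> ` H)"
  have bb: "bdd_below (\<Phi> ` H)"
    by (rule bdd_belowI2[OF bdd])
  have m_le: "m \<le> \<Phi> f" if "f \<in> H" for f
    unfolding m_def using that bb by (auto intro: cInf_lower)
  have "\<exists>f\<in>H. \<Phi> f < m + 1 / Suc n" for n
    using cInf_lessD[of "\<Phi> ` H" "m + 1 / Suc n"] zero_mem unfolding m_def by auto
  then obtain u where u: "\<And>n. u n \<in> H" and u_less: "\<And>n. \<Phi> (u n) < m + 1 / Suc n"
    by metis
  \<comment> \<open>Strong convexity at the midpoint, where \<open>s * (1 - s)\<close> is 1/4,
    together with the fact that the midpoint value is at least \<open>m\<close>.\<close>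
  have gap: "c / 4 * (ip_norm ip (\<lambda>x. f x - g x))\<^sup>2 \<le> (\<Phi> f - m) / 2 + (\<Phi> g - m) / 2"
    if "f \<in> H" "g \<in> H" for f g
    using strongly_convexD[OF sc that, of "1/2"] m_le[OF lincomb_mem[OF that, of "1 - 1/2" "1/2"]]
    by (simp add: field_simps)
  have Cauchy: "\<exists>N::nat. \<forall>i\<ge>N. \<forall>j\<ge>N. ip_norm ip (\<lambda>x. u i x - u j x) < e" if e: "0 < e" for e
  proof -
    have "0 < c / 4 * e\<^sup>2"
      using c e by simp
    then obtain N where N: "inverse (real (Suc N)) < c / 4 * e\<^sup>2"
      using reals_Archimedean by blast
    show ?thesis
    proof (intro exI[of _ N] allI impI)
      fix i j
      assume ij: "N \<le> i" "N \<le> j"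
      have near: "\<Phi> (u k) - m < inverse (real (Suc N))" if "N \<le> k" for k
      proof -
        have "1 / real (Suc k) \<le> inverse (real (Suc N))"
          using that by (simp add: field_simps)
        then show ?thesis
          using u_less[of k] by linarith
      qed
      have "(\<Phi> (u i) - m) / 2 + (\<Phi> (u j) - m) / 2 < inverse (real (Suc N))"
        using near[OF ij(1)] near[OF ij(2)] by argo
      then have "c / 4 * (ip_norm ip (\<lambda>x. u i x - u j x))\<^sup>2 < c / 4 * e\<^sup>2"
        using gap[OF u u, of i j] N by (meson le_less_trans less_trans)
      then have "(ip_norm ip (\<lambda>x. u i x - u j x))\<^sup>2 < e\<^sup>2"
        using c by simp
      then show "ip_norm ip (\<lambda>x. u i x - u j x) < e"
        by (rule power2_less_imp_less) (use e in simp)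
    qed
  qed
  from complete[of u, OF u Cauchy] obtain f
    where f: "f \<in> H" and lim: "(\<lambda>n. ip_norm ip (\<lambda>x. u n x - f x)) \<longlonglongrightarrow> 0" ..
  have "(\<lambda>n. m + 1 / real (Suc n)) \<longlonglongrightarrow> m"
    using tendsto_add[OF tendsto_const LIMSEQ_inverse_real_of_nat, of m]
    by (simp add: inverse_eq_divide)
  then have "\<Phi> f \<le> m"
    by (rule LIMSEQ_le[OF cont[of u f, OF u f lim]]) (use u_less less_imp_le in blast)
  then have f_min: "is_arg_min \<Phi> (\<lambda>h. h \<in> H) f"
    using f m_le by (force simp: is_arg_min_linorder)
  \<comment> \<open>Growth at \<open>f\<close> applied to a second minimizer \<open>h\<close> forces
    their distance to be 0.\<close>
  have "h = f" if h_min: "is_arg_min \<Phi> (\<lambda>h. h \<in> H) h" for h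
  proof -
    have h: "h \<in> H" and "\<Phi> h \<le> \<Phi> f"
      using h_min f by (auto simp: is_arg_min_linorder)
    then have "c * (ip_norm ip (\<lambda>x. f x - h x))\<^sup>2 \<le> 0"
      using strongly_convex_growth[OF sc f_min h] by linarith
    then have "ip (\<lambda>x. f x - h x) (\<lambda>x. f x - h x) = 0"
      using c ip_ge_zero[OF diff_mem[OF f h]]
      by (simp add: ip_norm_sq diff_mem f h mult_le_0_iff)
    then have "(\<lambda>x. f x - h x) = (\<lambda>_. 0)"
      using ip_eq_zero_iff diff_mem f h by blast
    then show ?thesis
      by (auto simp: fun_eq_iff)
  qed
  then show ?thesis
    using f_min by blast
qed

text \<open>The weighted losses are convex and the regularizer contributes the whole gap. The
  constant is exactly \<open>lam\<close> because \<open>strongly_convex\<close> is normalized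
  without the customary factor 1/2.\<close>

lemma strongly_convex_regularized_objective:
  assumes convex: "convex_loss Y L" and Z: "Z \<in> samples Y" and q: "\<And>t. 0 \<le> q $ t"
  shows "strongly_convex lam (regularized_objective ip L lam q Z)"
  unfolding strongly_convex_def
proof (intro ballI)
  fix f g and s :: real
  assume f: "f \<in> H" and g: "g \<in> H" and s: "s \<in> {0..1}"
  let ?l = "\<lambda>h t. L (h (fst (Z $ t))) (snd (Z $ t))"
  let ?k = "\<lambda>x. (1 - s) * f x + s * g x"
  have "?l ?k t \<le> (1 - s) * ?l f t + s * ?l g t" for t
  proof -
    have "snd (Z $ t) \<in> Y"
      using Z by (auto simp: samples_def mem_Times_iff)
    then have "convex_on UNIV (\<lambda>u. L u (snd (Z $ t)))"
      using convex by (simp add: convex_loss_def)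
    then show ?thesis
      using convex_onD[of UNIV _ s "f (fst (Z $ t))" "g (fst (Z $ t))"] s by auto
  qed
  then have "(\<Sum>t\<in>UNIV. q $ t * ?l ?k t) \<le> (\<Sum>t\<in>UNIV. q $ t * ((1 - s) * ?l f t + s * ?l g t))"
    by (intro sum_mono mult_left_mono q)
  also have "\<dots> = (1 - s) * (\<Sum>t\<in>UNIV. q $ t * ?l f t) + s * (\<Sum>t\<in>UNIV. q $ t * ?l g t)"
    by (simp add: sum_distrib_left sum.distrib[symmetric] algebra_simps)
  finally show "regularized_objective ip L lam q Z ?k \<le>
      (1 - s) * regularized_objective ip L lam q Z f + s * regularized_objective ip L lam q Z g
        - lam * s * (1 - s) * (ip_norm ip (\<lambda>x. f x - g x))\<^sup>2"
    unfolding regularized_objective_def ip_norm_sq_segment[OF f g] by (simp add: algebra_simps)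
qed

end

section \<open>Reproducing kernels: Lipschitz losses, minimizers and stability\<close>

context rkhs
begin

text \<open>Evaluation at \<open>x\<close> is the inner product with \<open>K x\<close>, whose norm
  is the square root of \<open>K x x\<close>. Since \<open>r\<close> is fixed only through its
  square, \<open>\<bar>r\<bar>\<close> appears.\<close>

lemma abs_eval_le:
  assumes h: "h \<in> H" and bdd: "bdd_above (range (\<lambda>x. K x x))" and r: "r\<^sup>2 = (SUP x. K x x)"
  shows "\<bar>h x\<bar> \<le> \<bar>r\<bar> * ip_norm ip h"
proof -
  have "K x x \<le> r\<^sup>2"
    unfolding r by (rule cSUP_upper[OF UNIV_I bdd])
  then have "ip_norm ip (K x) \<le> \<bar>r\<bar>"
    using real_sqrt_le_mono by (fastforce simp: ip_norm_def reproducing kernel_mem)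
  then have "ip_norm ip h * ip_norm ip (K x) \<le> ip_norm ip h * \<bar>r\<bar>"
    using ip_norm_ge_zero[OF h] by (rule mult_left_mono)
  then show ?thesis
    using Cauchy_Schwarz[OF h kernel_mem, of x] by (simp add: reproducing h mult.commute)
qed

text \<open>Turns the pointwise bound of admissibility into one in the norm of \<open>H\<close>. It
  yields the continuity of the objective, the distance bound between minimizers, and the final
  passage from that distance to losses.\<close>

lemma loss_lipschitz:
  assumes adm: "admissible_loss H Y L \<sigma>"
    and bdd: "bdd_above (range (\<lambda>x. K x x))" and r: "r\<^sup>2 = (SUP x. K x x)"
    and f: "f \<in> H" and g: "g \<in> H" and y: "y \<in> Y"
  shows "\<bar>L (f x) y - L (g x) y\<bar> \<le> \<bar>\<sigma>\<bar> * \<bar>r\<bar> * ip_norm ip (\<lambda>x. f x - g x)"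
proof -
  have "\<bar>L (f x) y - L (g x) y\<bar> \<le> \<sigma> * \<bar>f x - g x\<bar>"
    using adm f g y by (fastforce simp: admissible_loss_def)
  also have "\<dots> \<le> \<bar>\<sigma>\<bar> * \<bar>f x - g x\<bar>"
    by (simp add: mult_right_mono)
  also have "\<dots> \<le> \<bar>\<sigma>\<bar> * (\<bar>r\<bar> * ip_norm ip (\<lambda>x. f x - g x))"
    using abs_eval_le[OF diff_mem[OF f g] bdd r, of x] by (intro mult_left_mono) auto
  finally show ?thesis
    by (simp add: mult.assoc)
qed

lemma tendsto_regularized_objective:
  assumes adm: "admissible_loss H Y L \<sigma>"
    and bdd: "bdd_above (range (\<lambda>x. K x x))" and r: "r\<^sup>2 = (SUP x. K x x)"
    and Z: "Z \<in> samples Y"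
    and u: "\<And>n::nat. u n \<in> H" and f: "f \<in> H"
    and lim: "(\<lambda>n. ip_norm ip (\<lambda>x. u n x - f x)) \<longlonglongrightarrow> 0"
  shows "(\<lambda>n. regularized_objective ip L lam q Z (u n))
    \<longlonglongrightarrow> regularized_objective ip L lam q Z f"
proof -
  have loss: "(\<lambda>n. L (u n x) y) \<longlonglongrightarrow> L (f x) y" if "y \<in> Y" for x y
  proof (rule LIM_zero_cancel)
    have "(\<lambda>n. \<bar>\<sigma>\<bar> * \<bar>r\<bar> * ip_norm ip (\<lambda>x. u n x - f x)) \<longlonglongrightarrow> 0"
      using tendsto_mult_right_zero[OF lim] .
    then show "(\<lambda>n. L (u n x) y - L (f x) y) \<longlonglongrightarrow> 0"
      by (rule Lim_null_comparison[rotated])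
        (use loss_lipschitz[OF adm bdd r u f that] in simp)
  qed
  have "snd (Z $ t) \<in> Y" for t
    using Z by (auto simp: samples_def mem_Times_iff)
  then show ?thesis
    unfolding regularized_objective_def
    by (intro tendsto_intros loss tendsto_ip_norm_sq u f lim)
qed

lemma regularized_objective_ex1_arg_min:
  assumes bdd: "bdd_above (range (\<lambda>x. K x x))" and r: "r\<^sup>2 = (SUP x. K x x)"
    and nonneg: "\<And>u y. y \<in> Y \<Longrightarrow> 0 \<le> L u y"
    and "convex_loss Y L" and adm: "admissible_loss H Y L \<sigma>"
    and q: "\<And>t. 0 \<le> q $ t" and lam: "0 < lam" and Z: "Z \<in> samples Y"
  shows "\<exists>!h. is_arg_min (regularized_objective ip L lam q Z) (\<lambda>h. h \<in> H) h"
proof (rule strongly_convex_ex1_arg_min[where b = 0])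
  show "strongly_convex lam (regularized_objective ip L lam q Z)"
    using assms by (intro strongly_convex_regularized_objective)
  show "0 \<le> regularized_objective ip L lam q Z f" for f
    using Z lam unfolding regularized_objective_def
    by (intro add_nonneg_nonneg sum_nonneg mult_nonneg_nonneg q nonneg)
      (auto simp: samples_def mem_Times_iff)
  show "(\<lambda>n. regularized_objective ip L lam q Z (u n))
      \<longlonglongrightarrow> regularized_objective ip L lam q Z f"
    if "\<And>n. u n \<in> H" "f \<in> H" "(\<lambda>n. ip_norm ip (\<lambda>x. u n x - f x)) \<longlonglongrightarrow> 0" for u f
    by (rule tendsto_regularized_objective[OF adm bdd r Z]) (fact that)+
qed fact

lemma arg_min_diff_norm_le:
  assumes bdd: "bdd_above (range (\<lambda>x. K x x))" and r: "r\<^sup>2 = (SUP x. K x x)"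
    and convex: "convex_loss Y L" and adm: "admissible_loss H Y L \<sigma>"
    and q: "\<And>t. 0 \<le> q $ t" and lam: "0 < lam"
    and Z: "Z \<in> samples Y" "Z' \<in> samples Y" and differ: "differ_by_one Z Z'"
    and h: "is_arg_min (regularized_objective ip L lam q Z) (\<lambda>h. h \<in> H) h"
    and h': "is_arg_min (regularized_objective ip L lam q Z') (\<lambda>h. h \<in> H) h'"
  shows "lam * ip_norm ip (\<lambda>x. h x - h' x) \<le> infnorm q * \<bar>\<sigma>\<bar> * \<bar>r\<bar>"
proof -
  let ?F = "regularized_objective ip L lam q"
  let ?l = "\<lambda>h z. L (h (fst z)) (snd z)"
  let ?D = "ip_norm ip (\<lambda>x. h x - h' x)"
  have mem: "h \<in> H" "h' \<in> H"
    using h h' by (auto simp: is_arg_min_linorder)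
  have D0: "0 \<le> ?D"
    by (intro ip_norm_ge_zero diff_mem mem)
  have Y: "snd (Z $ t) \<in> Y" "snd (Z' $ t) \<in> Y" for t
    using Z by (auto simp: samples_def mem_Times_iff)
  obtain t where t: "\<And>s. s \<noteq> t \<Longrightarrow> Z $ s = Z' $ s"
    using differ by (auto simp: differ_by_one_def)
  \<comment> \<open>The regularizer and all terms of index other than \<open>t\<close>
    cancel.\<close>
  have swap: "?F Z f - ?F Z' f = q $ t * (?l f (Z $ t) - ?l f (Z' $ t))" for f
  proof -
    have "?F Z f - ?F Z' f = (\<Sum>s\<in>UNIV. q $ s * (?l f (Z $ s) - ?l f (Z' $ s)))"
      by (simp add: regularized_objective_def sum_subtractf algebra_simps)
    also have "\<dots> = (\<Sum>s\<in>UNIV. if s = t then q $ t * (?l f (Z $ t) - ?l f (Z' $ t)) else 0)"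
      by (intro sum.cong) (auto simp: t)
    finally show ?thesis
      by simp
  qed
  have "?F Z h + lam * ?D\<^sup>2 \<le> ?F Z h'"
    using strongly_convex_growth[OF strongly_convex_regularized_objective[OF convex Z(1) q] h mem(2)] .
  moreover have "?F Z' h' + lam * ?D\<^sup>2 \<le> ?F Z' h"
    using strongly_convex_growth[OF strongly_convex_regularized_objective[OF convex Z(2) q] h' mem(1)]
    by (simp add: ip_norm_diff_commute[OF mem])
  ultimately have "2 * (lam * ?D\<^sup>2) \<le>
      q $ t * (?l h' (Z $ t) - ?l h' (Z' $ t)) - q $ t * (?l h (Z $ t) - ?l h (Z' $ t))"
    using swap[of h] swap[of h'] by linarith
  \<comment> \<open>Regrouped so that each difference compares \<open>h\<close> and
    \<open>h'\<close> at one and the same sample point, as \<open>loss_lipschitz\<close>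
    requires.\<close>
  also have "\<dots> = q $ t * ((?l h' (Z $ t) - ?l h (Z $ t)) + (?l h (Z' $ t) - ?l h' (Z' $ t)))"
    by (simp add: algebra_simps)
  also have "\<dots> \<le> q $ t * (\<bar>\<sigma>\<bar> * \<bar>r\<bar> * ?D + \<bar>\<sigma>\<bar> * \<bar>r\<bar> * ?D)"
    using loss_lipschitz[OF adm bdd r mem Y(1), of "fst (Z $ t)" t]
      loss_lipschitz[OF adm bdd r mem Y(2), of "fst (Z' $ t)" t]
    by (intro mult_left_mono q) linarith
  also have "\<dots> \<le> infnorm q * (\<bar>\<sigma>\<bar> * \<bar>r\<bar> * ?D + \<bar>\<sigma>\<bar> * \<bar>r\<bar> * ?D)"
    using component_le_infnorm_cart[of q t] D0 by (intro mult_right_mono) auto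
  finally have "?D * (lam * ?D) \<le> ?D * (infnorm q * \<bar>\<sigma>\<bar> * \<bar>r\<bar>)"
    by (simp add: power2_eq_square algebra_simps)
  \<comment> \<open>Cancel \<open>?D\<close> if it is nonzero; otherwise the left side is 0 and the
    right side is non-negative.\<close>
  then show ?thesis
    using D0 infnorm_pos_le[of q] by (cases "?D = 0") auto
qed

text \<open>One factor \<open>\<bar>\<sigma>\<bar> * \<bar>r\<bar>\<close> comes from the distance
  of the minimizers and one from the Lipschitz bound on the loss, hence the squares.\<close>

lemma kernel_regularization_uniformly_stable:
  fixes q :: "real ^ 'n"
  assumes bdd: "bdd_above (range (\<lambda>x. K x x))" and r: "r\<^sup>2 = (SUP x. K x x)"
    and nonneg: "\<And>u y. y \<in> Y \<Longrightarrow> 0 \<le> L u y"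
    and convex: "convex_loss Y L" and adm: "admissible_loss H Y L \<sigma>"
    and q: "\<And>t. 0 \<le> q $ t" and lam: "0 < lam"
  shows "uniformly_stable Y L (kernel_regularization H ip L lam q)
    (\<sigma>\<^sup>2 * r\<^sup>2 * infnorm q / lam)"
  unfolding uniformly_stable_def
proof (clarify)
  fix Z Z' :: "('x \<times> real) ^ 'n" and x y
  assume Z: "Z \<in> samples Y" "Z' \<in> samples Y" and differ: "differ_by_one Z Z'" and y: "y \<in> Y"
  define h where "h = kernel_regularization H ip L lam q Z"
  define h' where "h' = kernel_regularization H ip L lam q Z'"
  \<comment> \<open>\<open>arg_min\<close> is a choice operator, so existence of a minimizer is what
    makes the chosen function one.\<close>
  have min: "is_arg_min (regularized_objective ip L lam q W) (\<lambda>h. h \<in> H)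
      (kernel_regularization H ip L lam q W)" if "W \<in> samples Y" for W
    unfolding kernel_regularization_def arg_min_def
    using regularized_objective_ex1_arg_min[OF bdd r nonneg convex adm q lam that]
    by (metis (no_types, lifting) someI_ex)
  have h: "is_arg_min (regularized_objective ip L lam q Z) (\<lambda>h. h \<in> H) h"
    and h': "is_arg_min (regularized_objective ip L lam q Z') (\<lambda>h. h \<in> H) h'"
    using min Z by (auto simp: h_def h'_def)
  let ?D = "ip_norm ip (\<lambda>x. h x - h' x)"
  have D: "?D \<le> infnorm q * \<bar>\<sigma>\<bar> * \<bar>r\<bar> / lam"
    using arg_min_diff_norm_le[OF bdd r convex adm q lam Z differ h h'] lam
    by (simp add: field_simps)
  have "\<bar>L (h x) y - L (h' x) y\<bar> \<le> \<bar>\<sigma>\<bar> * \<bar>r\<bar> * ?D"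
    using h h' y by (intro loss_lipschitz[OF adm bdd r]) (auto simp: is_arg_min_linorder)
  also have "\<dots> \<le> \<bar>\<sigma>\<bar> * \<bar>r\<bar> * (infnorm q * \<bar>\<sigma>\<bar> * \<bar>r\<bar> / lam)"
    using D by (intro mult_left_mono) auto
  also have "\<dots> = \<bar>\<sigma>\<bar>\<^sup>2 * \<bar>r\<bar>\<^sup>2 * infnorm q / lam"
    by (simp only: power2_eq_square times_divide_eq_right mult_ac)
  finally show "\<bar>L (kernel_regularization H ip L lam q Z x) y
      - L (kernel_regularization H ip L lam q Z' x) y\<bar> \<le> \<sigma>\<^sup>2 * r\<^sup>2 * infnorm q / lam"
    by (simp add: h_def h'_def)
qed

end

text \<open>The first conjunct ensures that the algorithm, defined by choice, returns the unique
  minimizer on every sample over \<open>Y\<close>. In the second, the bound itself serves as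
  \<open>\<beta>\<close>.\<close>

theorem theorem9:
  fixes K :: "'x \<Rightarrow> 'x \<Rightarrow> real"
    and H :: "('x \<Rightarrow> real) set"
    and ip :: "('x \<Rightarrow> real) \<Rightarrow> ('x \<Rightarrow> real) \<Rightarrow> real"
    and Y :: "real set"
    and L :: "real \<Rightarrow> real \<Rightarrow> real"
    and q :: "real ^ 'n"
    and r \<sigma> lam :: real
  assumes "pds_kernel K"
    and "bdd_above (range (\<lambda>x. K x x))"
    and "r\<^sup>2 = (SUP x. K x x)"
    and "rkhs H ip K"
    and "\<And>u y. y \<in> Y \<Longrightarrow> 0 \<le> L u y"
    and "convex_loss Y L"
    and "admissible_loss H Y L \<sigma>"
    and "\<And>t. 0 \<le> q $ t"
    and "0 < lam"
  shows "(\<forall>Z\<in>samples Y. \<exists>!h. is_arg_min (regularized_objective ip L lam q Z) (\<lambda>h. h \<in> H) h) \<and>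
    (\<exists>\<beta>. \<beta> \<le> \<sigma>\<^sup>2 * r\<^sup>2 * infnorm q / lam \<and>
      uniformly_stable Y L (kernel_regularization H ip L lam q) \<beta>)"
proof -
  interpret rkhs H ip K
    by fact
  show ?thesis
    using regularized_objective_ex1_arg_min[OF assms(2,3,5-9)]
      kernel_regularization_uniformly_stable[OF assms(2,3,5-9)]
    by blast
qed

end
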